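(* Let $P$ be a fixed finite ranked poset of rank $k$ with least and greatest elements, and let $b(P)=\sum_{x\in P}\operatorname{rank}x$. For every integer $n\ge k$, the number of chain quilts of type $(P,C_n)$ is given by a polynomial in $n$, namely $$|\mathrm{Quilts}(P,C_n)|=\sum_{m=k}^{b(P)}|F_m(P)|\binom{n}{m},$$ where $F_m(P)$ is the set of $m$-fundamental quilts for $P$. In particular, as $n\to\infty$, $$|\mathrm{Quilts}(P,C_n)|\sim\frac{|S(P)|}{b(P)!}\cdot n^{b(P)},$$ where $S(P)=F_{b(P)}(P)$ is the set of standard quilts for $P$.
   Context: $\mathbb N=\{0,1,2,\dots\}$, $[m]=\{1,\dots,m\}$. All posets are finite, ranked (all maximal chains have the same size), and have a least element $\hat 0$ and a greatest element $\hat 1$. $x\lessdot y$ means $y$ covers $x$. The rank function satisfies $\operatorname{rank}\hat 0=0$ and $\operatorname{rank}y=\operatorname{rank}x+1$ if $x\lessdot y$; $\operatorname{rank}P=\operatorname{rank}\hat 1_P$. $C_n$ is the chain $\{0<1<\dots<n\}$. $P\times Q$ carries the product order. $a_n\sim b_n$ means $a_n/b_n\to1$. A quilt of type $(P,Q)$ is a map $f:P\times Q\to\mathbb N$ such that: (i) $f(x,y)=0$ whenever $x=\hat 0_P$ or $y=\hat 0_Q$; (ii) $f(\hat 1_P,\hat 1_Q)=\min\{\operatorname{rank}P,\operatorname{rank}Q\}$; (iii) if $(x,y)\lessdot(x',y')$ in $P\times Q$, then $f(x',y')\in\{f(x,y),f(x,y)+1\}$. $\mathrm{Quilts}(P,Q)$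 is the set of all quilts of type $(P,Q)$. For $f\in\mathrm{Quilts}(P,C_{b(P)})$, an element $i\in[b(P)]$ is a jump for $f$ if there is $x\in P$ with $f(x,i)=f(x,i-1)+1$. The quilt $f\in \mathrm{Quilts}(P,C_{b(P)})$ is $m$-fundamental for $P$ if its set of jumps equals $[m]$, and standard if it is $b(P)$-fundamental. *)

theory Defs
  imports Complex_Main "HOL-Library.FuncSet" "HOL-Library.Product_Order"
    "HOL-Computational_Algebra.Polynomial"
begin

text \<open>A poset is a carrier set inside an arbitrary partially ordered type, with the induced
  order. Least and greatest elements are the library's \<open>LEAST x. x \<in> P\<close> and
  \<open>GREATEST x. x \<in> P\<close>, which only require a partial order. The product \<open>P \<times> Q\<close> carries the
  componentwise order of \<^theory>\<open>HOL-Library.Product_Order\<close>.\<close>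

definition covers_in :: "'a::order set \<Rightarrow> 'a \<Rightarrow> 'a \<Rightarrow> bool" where
  "covers_in P x y \<longleftrightarrow> x \<in> P \<and> y \<in> P \<and> x < y \<and> \<not> (\<exists>z\<in>P. x < z \<and> z < y)"

definition ranked_poset :: "'a::order set \<Rightarrow> bool" where
  "ranked_poset P \<longleftrightarrow>
     finite P \<and> (\<exists>x\<in>P. \<forall>y\<in>P. x \<le> y) \<and> (\<exists>x\<in>P. \<forall>y\<in>P. y \<le> x) \<and>
     (\<forall>C D. pred_on.maxchain P (<) C \<longrightarrow> pred_on.maxchain P (<) D \<longrightarrow> card C = card D)"

text \<open>The value 0 outside \<open>P\<close> is a convention that makes the description unique as a total
  function; for a ranked poset such a function exists.\<close>

definition rank_fun :: "'a::order set \<Rightarrow> 'a \<Rightarrow> nat" where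
  "rank_fun P = (THE r. r (LEAST x. x \<in> P) = 0 \<and>
     (\<forall>x y. covers_in P x y \<longrightarrow> r y = r x + 1) \<and> (\<forall>x. x \<notin> P \<longrightarrow> r x = 0))"

definition poset_rank :: "'a::order set \<Rightarrow> nat" where
  "poset_rank P = rank_fun P (GREATEST x. x \<in> P)"

definition chain_poset :: "nat \<Rightarrow> nat set" where
  "chain_poset n = {0..n}"

text \<open>Maps \<open>P \<times> Q \<rightarrow> \<nat>\<close> are extensional functions, so that they are determined by their
  values on \<open>P \<times> Q\<close> and can be counted.\<close>

definition quilts :: "'a::order set \<Rightarrow> 'b::order set \<Rightarrow> ('a \<times> 'b \<Rightarrow> nat) set" where
  "quilts P Q = {f \<in> P \<times> Q \<rightarrow>\<^sub>E UNIV.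
     (\<forall>x\<in>P. \<forall>y\<in>Q. x = (LEAST x. x \<in> P) \<or> y = (LEAST y. y \<in> Q) \<longrightarrow> f (x, y) = 0) \<and>
     f (GREATEST x. x \<in> P, GREATEST y. y \<in> Q) = min (poset_rank P) (poset_rank Q) \<and>
     (\<forall>x y x' y'. covers_in (P \<times> Q) (x, y) (x', y') \<longrightarrow>
        f (x', y') \<in> {f (x, y), f (x, y) + 1})}"

definition rank_sum :: "'a::order set \<Rightarrow> nat" where
  "rank_sum P = (\<Sum>x\<in>P. rank_fun P x)"

definition jumps :: "'a::order set \<Rightarrow> ('a \<times> nat \<Rightarrow> nat) \<Rightarrow> nat set" where
  "jumps P f = {i \<in> {1..rank_sum P}. \<exists>x\<in>P. f (x, i) = f (x, i - 1) + 1}"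

definition fundamental_quilts :: "nat \<Rightarrow> 'a::order set \<Rightarrow> ('a \<times> nat \<Rightarrow> nat) set" where
  "fundamental_quilts m P = {f \<in> quilts P (chain_poset (rank_sum P)). jumps P f = {1..m}}"

definition standard_quilts :: "'a::order set \<Rightarrow> ('a \<times> nat \<Rightarrow> nat) set" where
  "standard_quilts P = fundamental_quilts (rank_sum P) P"

end

theory Submission
  imports Defs
begin

text \<open>Read a quilt of type \<open>(P, C\<^sub>n)\<close> as the sequence of its rows \<open>f(\<cdot>, i)\<close>. It is a walk of
  \<open>n\<close> steps from the zero map to the rank function in the finite set of admissible maps
  \<open>P \<rightarrow> \<nat>\<close>, each step being either trivial or strict, and its jumps are the strict steps.
  Choosing which of the \<open>n\<close> steps are strict gives the binomial formula. A strict walk raises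
  \<open>\<Sum>x\<in>P. g x\<close> at every step, hence has at most \<open>b(P)\<close> steps, and the value at the greatest
  element by at most one, hence it has at least \<open>k\<close> steps. Walks raising a single value at each step exist, so
  the top coefficient does not vanish.\<close>

subsection \<open>Walks\<close>

text \<open>A walk of \<open>n\<close> steps is prolonged by its end point \<open>t\<close>, so that walks of different
  lengths share one type.\<close>

definition walks :: "('s \<Rightarrow> 's \<Rightarrow> bool) \<Rightarrow> nat \<Rightarrow> 's \<Rightarrow> 's \<Rightarrow> (nat \<Rightarrow> 's) set" where
  "walks R n s t = {g. g 0 = s \<and> (\<forall>i<n. R (g i) (g (Suc i))) \<and> (\<forall>i\<ge>n. g i = t)}"

lemma walks_0: "walks R 0 s t = (if s = t then {\<lambda>_. t} else {})"
  by (auto simp: walks_def)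

text \<open>Splits off the first step, since \<open>case_nat s\<close> prepends \<open>s\<close>.
  Removing steps from the front keeps the end point \<open>t\<close> fixed while inductions on the
  length vary the start.\<close>

lemma walks_Suc: "walks R (Suc n) s t = (\<Union>s'\<in>{s'. R s s'}. case_nat s ` walks R n s' t)"
proof (intro equalityI subsetI)
  fix g assume g: "g \<in> walks R (Suc n) s t"
  have "g = case_nat s (\<lambda>i. g (Suc i))"
    using g by (auto simp: walks_def fun_eq_iff split: nat.split)
  moreover have "(\<lambda>i. g (Suc i)) \<in> walks R n (g 1) t" "R s (g 1)"
    using g by (auto simp: walks_def)
  ultimately show "g \<in> (\<Union>s'\<in>{s'. R s s'}. case_nat s ` walks R n s' t)" by blast
next
  fix g assume "g \<in> (\<Union>s'\<in>{s'. R s s'}. case_nat s ` walks R n s' t)"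
  then show "g \<in> walks R (Suc n) s t"
    by (auto simp: walks_def less_Suc_eq_0_disj Suc_le_eq split: nat.split)
qed

lemma finite_walks:
  assumes "\<And>s. finite {s'. R s s'}"
  shows "finite (walks R n s t)"
  by (induction n arbitrary: s) (auto simp: walks_0 walks_Suc assms)

text \<open>Prepending \<open>s\<close> is injective and walks from distinct second points are
  distinct, so the union in \<open>walks_Suc\<close> is disjoint and the cardinalities add.\<close>

lemma card_walks_Suc:
  assumes "\<And>s. finite {s'. R s s'}"
  shows "card (walks R (Suc n) s t) = (\<Sum>s' | R s s'. card (walks R n s' t))"
proof -
  have inj: "inj_on (case_nat s) A" for A :: "(nat \<Rightarrow> 'a) set"
    by (rule inj_onI) (metis nat.case(2) ext)
  have "case_nat s ` walks R n a t \<inter> case_nat s ` walks R n b t = {}" if "a \<noteq> b" for a b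
  proof -
    have "walks R n a t \<inter> walks R n b t = {}" using that by (auto simp: walks_def)
    then show ?thesis by (metis inj image_Int image_empty)
  qed
  then show ?thesis
    unfolding walks_Suc
    by (subst card_UN_disjoint) (auto simp: assms finite_walks card_image[OF inj])
qed

text \<open>By induction instead of an explicit choice of positions: the first step either rests at
  \<open>s\<close> or is strict, irreflexivity separates the two cases, and Pascal's rule recombines
  them.\<close>

lemma card_walks_reflclp:
  fixes R :: "'s \<Rightarrow> 's \<Rightarrow> bool"
  assumes fin: "\<And>s. finite {s'. R s s'}" and irrefl: "\<And>s. \<not> R s s"
  shows "card (walks R\<^sup>=\<^sup>= n s t) = (\<Sum>m\<le>n. card (walks R m s t) * (n choose m))"
proof (induction n arbitrary: s)
  case 0
  then show ?case by (simp add: walks_0)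
next
  case (Suc n)
  let ?S = "\<lambda>m s. card (walks R m s t)"
  have eq: "{s'. R\<^sup>=\<^sup>= s s'} = insert s {s'. R s s'}" for s by auto
  have "card (walks R\<^sup>=\<^sup>= (Suc n) s t) = (\<Sum>s' | R\<^sup>=\<^sup>= s s'. card (walks R\<^sup>=\<^sup>= n s' t))"
    by (rule card_walks_Suc) (simp only: eq finite_insert fin)
  also have "\<dots> = card (walks R\<^sup>=\<^sup>= n s t) + (\<Sum>s' | R s s'. card (walks R\<^sup>=\<^sup>= n s' t))"
    unfolding eq by (subst sum.insert) (simp_all add: fin irrefl)
  also have "(\<Sum>s' | R s s'. card (walks R\<^sup>=\<^sup>= n s' t)) = (\<Sum>m\<le>n. ?S (Suc m) s * (n choose m))"
    unfolding Suc.IH by (subst sum.swap) (simp add: card_walks_Suc[OF fin] sum_distrib_right)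
  \<comment> \<open>The added summand vanishes because \<open>n choose Suc n = 0\<close>; it lets
    the index shift produce the same range as in the strict case.\<close>
  also have "card (walks R\<^sup>=\<^sup>= n s t) = (\<Sum>m\<le>Suc n. ?S m s * (n choose m))"
    by (simp add: Suc.IH)
  also have "\<dots> = ?S 0 s + (\<Sum>m\<le>n. ?S (Suc m) s * (n choose Suc m))"
    by (subst sum.atMost_Suc_shift) simp
  also have "?S 0 s + (\<Sum>m\<le>n. ?S (Suc m) s * (n choose Suc m)) + (\<Sum>m\<le>n. ?S (Suc m) s * (n choose m))
      = (\<Sum>m\<le>Suc n. ?S m s * (Suc n choose m))"
    unfolding sum.atMost_Suc_shift by (simp add: sum.distrib[symmetric] algebra_simps)
  finally show ?case .
qed

subsection \<open>Rank functions\<close>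

lemma lower_cover_exists:
  assumes "finite P" "x \<in> P" "y \<in> P" "x < y"
  shows "\<exists>z. covers_in P z y"
proof -
  have "finite {z \<in> P. z < y}" "{z \<in> P. z < y} \<noteq> {}" using assms by auto
  from finite_has_maximal[OF this] show ?thesis
    unfolding covers_in_def using assms by (fastforce simp: less_le)
qed

lemma upper_cover_exists:
  assumes "finite P" "x \<in> P" "y \<in> P" "x < y"
  shows "\<exists>z. covers_in P x z"
proof -
  have "finite {z \<in> P. x < z}" "{z \<in> P. x < z} \<noteq> {}" using assms by auto
  from finite_has_minimal[OF this] show ?thesis
    unfolding covers_in_def using assms by (fastforce simp: less_le)
qed

lemma Least_mem_le:
  fixes P :: "'a::order set"
  assumes "\<exists>x\<in>P. \<forall>y\<in>P. x \<le> y"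
  shows "(LEAST x. x \<in> P) \<in> P" "y \<in> P \<Longrightarrow> (LEAST x. x \<in> P) \<le> y"
proof -
  obtain x where x: "x \<in> P" "\<And>y. y \<in> P \<Longrightarrow> x \<le> y" using assms by blast
  then have "(LEAST x. x \<in> P) = x" by (intro Least_equality)
  then show "(LEAST x. x \<in> P) \<in> P" "y \<in> P \<Longrightarrow> (LEAST x. x \<in> P) \<le> y" using x by auto
qed

lemma Greatest_mem_ge:
  fixes P :: "'a::order set"
  assumes "\<exists>x\<in>P. \<forall>y\<in>P. y \<le> x"
  shows "(GREATEST x. x \<in> P) \<in> P" "y \<in> P \<Longrightarrow> y \<le> (GREATEST x. x \<in> P)"
proof -
  obtain x where x: "x \<in> P" "\<And>y. y \<in> P \<Longrightarrow> y \<le> x" using assms by blast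
  then have "(GREATEST x. x \<in> P) = x" by (intro Greatest_equality)
  then show "(GREATEST x. x \<in> P) \<in> P" "y \<in> P \<Longrightarrow> y \<le> (GREATEST x. x \<in> P)" using x by auto
qed

text \<open>Every element other than the least has a lower cover, and the number of elements
  strictly below decreases in passing to it.\<close>

lemma cover_up_induct [consumes 3, case_names least step]:
  fixes P :: "'a::order set"
  assumes "finite P" "x \<in> P" and least: "\<exists>x\<in>P. \<forall>y\<in>P. x \<le> y"
    and "Q (LEAST x. x \<in> P)" and step: "\<And>x y. covers_in P x y \<Longrightarrow> Q x \<Longrightarrow> Q y"
  shows "Q x"
  using \<open>x \<in> P\<close>
proof (induction "card {z \<in> P. z < x}" arbitrary: x rule: less_induct)
  case less
  show ?case
  proof (cases "x = (LEAST x. x \<in> P)")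
    case False
    then have "(LEAST x. x \<in> P) < x" using Least_mem_le[OF least] less.prems by (simp add: less_le)
    then obtain z where z: "covers_in P z x"
      using lower_cover_exists assms(1) Least_mem_le(1)[OF least] less.prems by blast
    then have "z \<in> P" "z < x" by (auto simp: covers_in_def)
    then have "{y \<in> P. y < z} \<subset> {y \<in> P. y < x}" by auto
    then have "card {y \<in> P. y < z} < card {y \<in> P. y < x}"
      using assms(1) by (intro psubset_card_mono) auto
    with less.hyps \<open>z \<in> P\<close> step z show ?thesis by blast
  qed (use assms in simp)
qed

lemma cover_down_induct [consumes 3, case_names greatest step]:
  fixes P :: "'a::order set"
  assumes "finite P" "x \<in> P" and greatest: "\<exists>x\<in>P. \<forall>y\<in>P. y \<le> x"
    and "Q (GREATEST x. x \<in> P)" and step: "\<And>x y. covers_in P x y \<Longrightarrow> Q y \<Longrightarrow> Q x"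
  shows "Q x"
  using \<open>x \<in> P\<close>
proof (induction "card {z \<in> P. x < z}" arbitrary: x rule: less_induct)
  case less
  show ?case
  proof (cases "x = (GREATEST x. x \<in> P)")
    case False
    then have "x < (GREATEST x. x \<in> P)" using Greatest_mem_ge[OF greatest] less.prems by (simp add: less_le)
    then obtain z where z: "covers_in P x z"
      using upper_cover_exists assms(1) Greatest_mem_ge(1)[OF greatest] less.prems by blast
    then have "z \<in> P" "x < z" by (auto simp: covers_in_def)
    then have "{y \<in> P. z < y} \<subset> {y \<in> P. x < y}" by auto
    then have "card {y \<in> P. z < y} < card {y \<in> P. x < y}"
      using assms(1) by (intro psubset_card_mono) auto
    with less.hyps \<open>z \<in> P\<close> step z show ?thesis by blast
  qed (use assms in simp)
qed

text \<open>Uniqueness: covers propagate the value from the least element to all of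
  \<open>P\<close>, and the convention fixes the rest. Any explicit candidate may thus replace the
  description operator.\<close>

lemma rank_fun_equality:
  fixes P :: "'a::order set"
  assumes "finite P" and least: "\<exists>x\<in>P. \<forall>y\<in>P. x \<le> y"
    and "r (LEAST x. x \<in> P) = 0" "\<And>x y. covers_in P x y \<Longrightarrow> r y = r x + 1"
    and "\<And>x. x \<notin> P \<Longrightarrow> r x = 0"
  shows "rank_fun P = r"
  unfolding rank_fun_def
proof (rule the_equality)
  fix r' :: "'a \<Rightarrow> nat"
  assume r': "r' (LEAST x. x \<in> P) = 0 \<and>
     (\<forall>x y. covers_in P x y \<longrightarrow> r' y = r' x + 1) \<and> (\<forall>x. x \<notin> P \<longrightarrow> r' x = 0)"
  have "r' x = r x" if "x \<in> P" for x
    using \<open>finite P\<close> that least by (induction rule: cover_up_induct) (use r' assms in auto)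
  then show "r' = r" using r' assms by (metis ext)
qed (use assms in auto)

section \<open>Ranks and covers in chains, covers in products\<close>

lemma rank_fun_chain_poset: "rank_fun (chain_poset n) = (\<lambda>i. if i \<le> n then i else 0)"
proof (rule rank_fun_equality)
  have "(LEAST x. x \<in> chain_poset n) = 0"
    by (rule Least_equality) (auto simp: chain_poset_def)
  then show "(if (LEAST x. x \<in> chain_poset n) \<le> n then LEAST x. x \<in> chain_poset n else 0) = 0"
    by simp
  fix i j assume "covers_in (chain_poset n) i j"
  then have "i < j" "j \<le> n" "\<not> Suc i < j" by (auto simp: covers_in_def chain_poset_def)
  then show "(if j \<le> n then j else 0) = (if i \<le> n then i else 0) + 1" by auto
qed (auto simp: chain_poset_def)

lemma Greatest_chain_poset: "(GREATEST x. x \<in> chain_poset n) = n"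
  by (rule Greatest_equality) (auto simp: chain_poset_def)

lemma Least_chain_poset: "(LEAST x. x \<in> chain_poset n) = 0"
  by (rule Least_equality) (auto simp: chain_poset_def)

lemma poset_rank_chain_poset: "poset_rank (chain_poset n) = n"
  by (simp add: poset_rank_def rank_fun_chain_poset Greatest_chain_poset)

lemma covers_in_chain_poset: "covers_in (chain_poset n) i j \<longleftrightarrow> j = Suc i \<and> j \<le> n"
proof
  assume "covers_in (chain_poset n) i j"
  then have "i < j" "j \<le> n" "\<not> Suc i < j" by (auto simp: covers_in_def chain_poset_def)
  then show "j = Suc i \<and> j \<le> n" by auto
qed (auto simp: covers_in_def chain_poset_def)

lemma covers_in_Times:
  "covers_in (P \<times> Q) (x, y) (x', y') \<longleftrightarrow>
     x = x' \<and> x \<in> P \<and> covers_in Q y y' \<or> y = y' \<and> y \<in> Q \<and> covers_in P x x'" (is "?L \<longleftrightarrow> ?R")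
proof
  assume L: ?L
  then have mem: "x \<in> P" "y \<in> Q" "x' \<in> P" "y' \<in> Q" and le: "x \<le> x'" "y \<le> y'"
    and ne: "x \<noteq> x' \<or> y \<noteq> y'"
    and none: "\<And>u v. u \<in> P \<Longrightarrow> v \<in> Q \<Longrightarrow> (x, y) < (u, v) \<Longrightarrow> \<not> (u, v) < (x', y')"
    by (auto simp: covers_in_def less_le)
  \<comment> \<open>If both coordinates moved, the corner \<open>(x, y')\<close> would lie strictly
    between the two pairs.\<close>
  have "x = x' \<or> y = y'" using none[of x y'] mem le by (auto simp: less_le)
  then show ?R
  proof
    assume "x = x'"
    moreover have "\<not> (y < z \<and> z < y')" if "z \<in> Q" for z
      using none[of x z] that mem \<open>x = x'\<close> by (auto simp: less_le)
    ultimately show ?thesis using mem le ne by (auto simp: covers_in_def less_le)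
  next
    assume "y = y'"
    moreover have "\<not> (x < z \<and> z < x')" if "z \<in> P" for z
      using none[of z y] that mem \<open>y = y'\<close> by (auto simp: less_le)
    ultimately show ?thesis using mem le ne by (auto simp: covers_in_def less_le)
  qed
next
  assume ?R
  then show ?L
    by (fastforce simp: covers_in_def less_le dest: antisym)
qed

subsection \<open>Existence of the rank function\<close>

definition order_chain :: "'a::order set \<Rightarrow> bool" where
  "order_chain C \<longleftrightarrow> (\<forall>x\<in>C. \<forall>y\<in>C. x \<le> y \<or> y \<le> x)"

lemma pred_on_chain_iff: "pred_on.chain P (<) C \<longleftrightarrow> C \<subseteq> P \<and> order_chain C"
  by (auto simp: pred_on.chain_def order_chain_def less_le)

text \<open>Longest by cardinality, not merely maximal under inclusion: the size then depends on
  \<open>A\<close> alone.\<close>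

definition longest_chain :: "'a::order set \<Rightarrow> 'a set \<Rightarrow> bool" where
  "longest_chain A C \<longleftrightarrow> C \<subseteq> A \<and> order_chain C \<and>
     (\<forall>D. D \<subseteq> A \<longrightarrow> order_chain D \<longrightarrow> card D \<le> card C)"

lemma longest_chain_exists:
  assumes "finite A" shows "\<exists>C. longest_chain A C"
proof -
  have "\<exists>C. (C \<subseteq> A \<and> order_chain C) \<and> (\<forall>D. D \<subseteq> A \<and> order_chain D \<longrightarrow> card D \<le> card C)"
  proof (rule Lattices_Big.ex_has_greatest_nat)
    show "{} \<subseteq> A \<and> order_chain {}" by (simp add: order_chain_def)
    show "\<forall>D. D \<subseteq> A \<and> order_chain D \<longrightarrow> card D < Suc (card A)"
      using card_mono[OF assms] by (simp add: less_Suc_eq_le)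
  qed
  then show ?thesis unfolding longest_chain_def by blast
qed

lemma longest_chain_mem:
  assumes "finite A" "longest_chain A C" "z \<in> A" "\<And>c. c \<in> C \<Longrightarrow> c \<le> z \<or> z \<le> c"
  shows "z \<in> C"
proof (rule ccontr)
  assume "z \<notin> C"
  moreover have "finite C" using assms finite_subset by (auto simp: longest_chain_def)
  moreover have "insert z C \<subseteq> A" "order_chain (insert z C)"
    using assms by (auto simp: longest_chain_def order_chain_def)
  then have "card (insert z C) \<le> card C" using assms by (auto simp: longest_chain_def)
  ultimately show False by simp
qed

text \<open>Nothing fits between \<open>x\<close> and \<open>y\<close>, so an element comparable to
  the whole glued chain is \<open>x\<close>, \<open>y\<close>, below \<open>x\<close> or above
  \<open>y\<close>; in the last two cases \<open>longest_chain_mem\<close> puts it into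
  \<open>C\<close> or \<open>D\<close>. Allowing \<open>x = y\<close> covers chains through a pair
  and through a single element at once.\<close>

lemma maxchain_through:
  fixes P :: "'a::order set"
  assumes "finite P" and xy: "covers_in P x y \<or> x = y \<and> x \<in> P"
    and C: "longest_chain {z \<in> P. z < x} C" and D: "longest_chain {z \<in> P. y < z} D"
  shows "pred_on.maxchain P (<) (C \<union> {x, y} \<union> D)"
    and "card (C \<union> {x, y} \<union> D) = card C + card {x, y} + card D"
proof -
  let ?M = "C \<union> {x, y} \<union> D"
  have le: "x \<le> y" "x \<in> P" "y \<in> P" and none: "\<And>z. z \<in> P \<Longrightarrow> x < z \<Longrightarrow> z < y \<Longrightarrow> False"
    using xy by (auto simp: covers_in_def)
  have CC: "\<And>c. c \<in> C \<Longrightarrow> c \<in> P \<and> c < x" "order_chain C"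
    and DD: "\<And>d. d \<in> D \<Longrightarrow> d \<in> P \<and> y < d" "order_chain D"
    using C D by (auto simp: longest_chain_def)
  have cd: "c \<le> d \<and> c \<le> y \<and> x \<le> d" if "c \<in> C" "d \<in> D" for c d
    using CC(1)[OF that(1)] DD(1)[OF that(2)] le by force
  have chain: "order_chain ?M"
    unfolding order_chain_def
  proof (intro ballI)
    fix u v assume "u \<in> ?M" "v \<in> ?M"
    moreover have "c \<le> x" "c \<le> y" if "c \<in> C" for c using CC(1)[OF that] le by auto
    moreover have "x \<le> d" "y \<le> d" if "d \<in> D" for d using DD(1)[OF that] le by auto
    ultimately show "u \<le> v \<or> v \<le> u"
      using CC(2) DD(2) cd le unfolding order_chain_def by blast
  qed
  have max: "S = ?M" if S: "S \<subseteq> P" "order_chain S" "?M \<subseteq> S" for S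
  proof -
    have "z \<in> ?M" if z: "z \<in> S" for z
    proof -
      have comp: "z \<le> w \<or> w \<le> z" if "w \<in> ?M" for w
        using S z that unfolding order_chain_def by blast
      have zP: "z \<in> P" using S z by auto
      have "z < x \<or> z = x \<or> z = y \<or> y < z"
        using comp[of x] comp[of y] none[OF zP] by (auto simp: less_le)
      moreover have "z \<in> C" if "z < x"
        using that zP comp assms(1) by (intro longest_chain_mem[OF _ C]) auto
      moreover have "z \<in> D" if "y < z"
        using that zP comp assms(1) by (intro longest_chain_mem[OF _ D]) auto
      ultimately show ?thesis by blast
    qed
    then show ?thesis using S by blast
  qed
  have sub: "?M \<subseteq> P" using CC DD le by auto
  show "pred_on.maxchain P (<) ?M"
    unfolding pred_on.maxchain_def pred_on_chain_iff using chain sub max by blast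
  have fin: "finite C" "finite D" using CC DD \<open>finite P\<close> by (meson finite_subset subsetI)+
  have "C \<inter> {x, y} = {}" using CC(1) le by fastforce
  then have "card (C \<union> {x, y}) = card C + card {x, y}"
    using fin by (intro card_Un_disjoint) auto
  moreover have "(C \<union> {x, y}) \<inter> D = {}"
    using CC(1) DD(1) le by (auto dest!: CC(1) DD(1) simp: less_le_not_le)
  then have "card ?M = card (C \<union> {x, y}) + card D"
    using fin by (intro card_Un_disjoint) auto
  ultimately show "card ?M = card C + card {x, y} + card D" by simp
qed

text \<open>The witness is the size of a longest chain strictly below \<open>x\<close>. Equal size
  of all maximal chains makes it grow by exactly one along covers.\<close>

lemma ranked_poset_rank_exists:
  fixes P :: "'a::order set"
  assumes "ranked_poset P"
  shows "\<exists>r. r (LEAST x. x \<in> P) = (0::nat) \<and>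
     (\<forall>x y. covers_in P x y \<longrightarrow> r y = r x + 1) \<and> (\<forall>x. x \<notin> P \<longrightarrow> r x = 0)"
proof -
  have fin: "finite P" and least: "\<exists>x\<in>P. \<forall>y\<in>P. x \<le> y"
    and same: "\<And>C D. pred_on.maxchain P (<) C \<Longrightarrow> pred_on.maxchain P (<) D \<Longrightarrow> card C = card D"
    using assms unfolding ranked_poset_def by blast+
  obtain C where C: "\<And>x. longest_chain {z \<in> P. z < x} (C x)"
    using choice[of "\<lambda>x C. longest_chain {z \<in> P. z < x} C"] fin by (auto simp: longest_chain_exists)
  obtain D where D: "\<And>x. longest_chain {z \<in> P. x < z} (D x)"
    using choice[of "\<lambda>x C. longest_chain {z \<in> P. x < z} C"] fin by (auto simp: longest_chain_exists)
  define r where "r x = (if x \<in> P then card (C x) else 0)" for x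
  have "r y = r x + 1" if "covers_in P x y" for x y
  proof -
    have xy: "x \<in> P" "y \<in> P" "x \<noteq> y" using that by (auto simp: covers_in_def)
    have 1: "covers_in P x y \<or> x = y \<and> x \<in> P" and 2: "covers_in P y y \<or> y = y \<and> y \<in> P"
      using that xy by auto
    \<comment> \<open>Both maximal chains have the same upper part \<open>D y\<close>, which
      cancels; the middle parts have sizes 2 and 1.\<close>
    have "card (C x \<union> {x, y} \<union> D y) = card (C y \<union> {y, y} \<union> D y)"
      using maxchain_through(1)[OF fin 1 C D] maxchain_through(1)[OF fin 2 C D] by (rule same)
    then have "card (C x) + card {x, y} + card (D y) = card (C y) + card {y, y} + card (D y)"
      unfolding maxchain_through(2)[OF fin 1 C D] maxchain_through(2)[OF fin 2 C D] .
    then show ?thesis using xy by (simp add: r_def)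
  qed
  moreover have "{z \<in> P. z < (LEAST x. x \<in> P)} = {}"
    using Least_mem_le(2)[OF least] by (blast dest: leD)
  then have "C (LEAST x. x \<in> P) = {}"
    using C[of "LEAST x. x \<in> P"] by (auto simp: longest_chain_def)
  then have "r (LEAST x. x \<in> P) = 0" by (simp add: r_def)
  ultimately show ?thesis by (intro exI[of _ r]) (simp add: r_def)
qed

subsection \<open>Quilts as walks\<close>

locale ranked =
  fixes P :: "'a::order set"
  assumes ranked: "ranked_poset P"
begin

abbreviation "bottom \<equiv> (LEAST x. x \<in> P)"
abbreviation "topmost \<equiv> (GREATEST x. x \<in> P)"
abbreviation "rk \<equiv> rank_fun P"

lemma fin: "finite P" and least: "\<exists>x\<in>P. \<forall>y\<in>P. x \<le> y" and greatest: "\<exists>x\<in>P. \<forall>y\<in>P. y \<le> x"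
  using ranked unfolding ranked_poset_def by blast+

lemmas bottom_mem = Least_mem_le(1)[OF least]
lemmas topmost_mem = Greatest_mem_ge(1)[OF greatest]

lemma rk_bottom: "rk bottom = 0"
  and rk_cover: "covers_in P x y \<Longrightarrow> rk y = rk x + 1"
  and rk_outside: "x \<notin> P \<Longrightarrow> rk x = 0"
proof -
  obtain r where r: "r bottom = (0::nat)" "\<And>x y. covers_in P x y \<Longrightarrow> r y = r x + 1"
    "\<And>x. x \<notin> P \<Longrightarrow> r x = 0"
    using ranked_poset_rank_exists[OF ranked] by blast
  then have "rk = r" by (intro rank_fun_equality[OF fin least])
  then show "rk bottom = 0" "covers_in P x y \<Longrightarrow> rk y = rk x + 1" "x \<notin> P \<Longrightarrow> rk x = 0"
    using r by auto
qed

section \<open>Admissible maps and strict steps between them\<close>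

definition states :: "('a \<Rightarrow> nat) set" where
  "states = {g. (\<forall>x. x \<notin> P \<longrightarrow> g x = 0) \<and> g bottom = 0 \<and>
     (\<forall>x y. covers_in P x y \<longrightarrow> g y \<in> {g x, g x + 1})}"

text \<open>Requiring both ends to be states makes the set of successors of any map finite.\<close>

definition step :: "('a \<Rightarrow> nat) \<Rightarrow> ('a \<Rightarrow> nat) \<Rightarrow> bool" where
  "step g h \<longleftrightarrow> g \<in> states \<and> h \<in> states \<and> g \<noteq> h \<and> (\<forall>x. h x \<in> {g x, g x + 1})"

lemma statesD:
  assumes "g \<in> states"
  shows "x \<notin> P \<Longrightarrow> g x = 0" "g bottom = 0" "covers_in P x y \<Longrightarrow> g y \<in> {g x, g x + 1}"
  using assms by (auto simp: states_def)

lemma stepD: "step g h \<Longrightarrow> h x \<in> {g x, g x + 1}"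
  by (simp add: step_def)

text \<open>Along a cover, \<open>g\<close> rises by at most one and the rank by exactly
  one.\<close>

lemma states_le_rk: "g \<in> states \<Longrightarrow> g x \<le> rk x"
proof (cases "x \<in> P")
  case True
  assume g: "g \<in> states"
  show ?thesis
    using fin True least
  proof (induction rule: cover_up_induct)
    case least
    then show ?case using g by (simp add: states_def)
  next
    case (step x y)
    then show ?case using statesD(3)[OF g step(1)] rk_cover[OF step(1)] by auto
  qed
qed (simp add: states_def)

lemma finite_states: "finite states"
proof -
  have "states \<subseteq> {g. \<forall>x. (x \<in> P \<longrightarrow> g x \<in> {..rank_sum P}) \<and> (x \<notin> P \<longrightarrow> g x = 0)}"
    using states_le_rk fin
    by (auto simp: states_def[unfolded mem_Collect_eq] rank_sum_def)
       (meson member_le_sum le_trans zero_le)+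
  then show ?thesis
    by (rule finite_subset) (rule finite_set_of_finite_funs[OF fin finite_atMost])
qed

lemma finite_step: "finite {h. step g h}"
  by (rule finite_subset[OF _ finite_states]) (auto simp: step_def)

lemma rk_state: "rk \<in> states"
  by (auto simp: states_def rk_bottom rk_cover rk_outside)

lemma zero_state: "(\<lambda>_. 0) \<in> states"
  by (auto simp: states_def)

text \<open>The deficit \<open>rk x - g x\<close> never decreases along a cover, so vanishing at the
  greatest element forces it to vanish everywhere. Hence the single corner condition of a quilt
  determines its last row.\<close>

lemma state_eq_rk:
  assumes g: "g \<in> states" "g topmost = rk topmost"
  shows "g = rk"
proof
  fix x show "g x = rk x"
  proof (cases "x \<in> P")
    case True
    show ?thesis
      using fin True greatest
    proof (induction rule: cover_down_induct)
      case (step x y)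
      then show ?case
        using statesD(3)[OF g(1) step(1)] rk_cover[OF step(1)] states_le_rk[OF g(1), of x] by auto
    qed (use g in simp)
  qed (use g rk_outside in \<open>simp add: states_def\<close>)
qed

lemma rank_le_rank_sum: "poset_rank P \<le> rank_sum P"
  unfolding poset_rank_def rank_sum_def using fin topmost_mem by (simp add: member_le_sum)

lemma step_sum_less: "step g h \<Longrightarrow> sum g P < sum h P"
proof (rule sum_strict_mono_ex1[OF fin])
  assume s: "step g h"
  show "\<forall>x\<in>P. g x \<le> h x"
  proof
    show "g x \<le> h x" for x using stepD[OF s, of x] by auto
  qed
  obtain x where "g x \<noteq> h x" using s by (auto simp: step_def)
  moreover have "x \<in> P" using s \<open>g x \<noteq> h x\<close> statesD(1)[of g x] statesD(1)[of h x] by (auto simp: step_def)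
  ultimately show "\<exists>x\<in>P. g x < h x" using stepD[OF s, of x] by force
qed

lemma walk_length:
  assumes g: "g \<in> walks step m (\<lambda>_. 0) rk"
  shows "poset_rank P \<le> m" "m \<le> rank_sum P"
proof -
  have g: "g 0 = (\<lambda>_. 0)" "\<And>i. i < m \<Longrightarrow> step (g i) (g (Suc i))" "g m = rk"
    using assms by (auto simp: walks_def)
  \<comment> \<open>At \<open>i = m\<close>, where the walk is at \<open>rk\<close>, the two bounds
    become the two claims.\<close>
  have "i \<le> m \<Longrightarrow> i \<le> sum (g i) P \<and> g i topmost \<le> i" for i
  proof (induction i)
    case (Suc i)
    then have "step (g i) (g (Suc i))" using g by simp
    then have "sum (g i) P < sum (g (Suc i)) P" "g (Suc i) topmost \<le> g i topmost + 1"
      using step_sum_less by (auto simp: step_def elim!: allE[of _ topmost])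
    then show ?case using Suc by auto
  qed (simp add: g)
  then show "poset_rank P \<le> m" "m \<le> rank_sum P"
    using g(3) by (fastforce simp: poset_rank_def rank_sum_def)+
qed

text \<open>Raise an element which is below its rank, of minimal value, and of maximal rank among
  those.\<close>

lemma unit_step_exists:
  assumes g: "g \<in> states" and less: "sum g P < rank_sum P"
  shows "\<exists>h. step g h \<and> sum h P = sum g P + 1"
proof -
  define D where "D = {x \<in> P. g x < rk x}"
  have "finite D" using fin by (simp add: D_def)
  have "D \<noteq> {}"
  proof
    assume "D = {}"
    then have "rk x \<le> g x" if "x \<in> P" for x using that by (auto simp: D_def not_less)
    then have "rank_sum P \<le> sum g P" unfolding rank_sum_def by (rule sum_mono)
    with less show False by simp
  qed
  define t where "t = Min (g ` D)"
  have t_le: "t \<le> g x" if "x \<in> D" for x using that \<open>finite D\<close> by (simp add: t_def)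
  define E where "E = {x \<in> D. g x = t}"
  have "t \<in> g ` D" unfolding t_def using \<open>finite D\<close> \<open>D \<noteq> {}\<close> by simp
  then have "E \<noteq> {}" "finite E" using \<open>finite D\<close> by (auto simp: E_def)
  then have "Max (rk ` E) \<in> rk ` E" by simp
  then obtain x where x: "x \<in> E" "rk x = Max (rk ` E)" by auto
  have rk_le: "rk y \<le> rk x" if "y \<in> E" for y
    unfolding x(2) using that \<open>finite E\<close> by simp
  have xD: "x \<in> P" "g x < rk x" "g x = t" using x by (auto simp: E_def D_def)
  define h where "h = g(x := g x + 1)"
  \<comment> \<open>A lower cover \<open>w\<close> of smaller value would lie outside
    \<open>D\<close> by minimality of \<open>t\<close>, hence have full rank value, leaving no
    deficit at \<open>x\<close>.\<close>
  have "g w = g x" if "covers_in P w x" for w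
  proof (rule ccontr)
    assume "g w \<noteq> g x"
    moreover have "g x \<in> {g w, g w + 1}" using g that by (auto simp: states_def)
    ultimately have "g x = g w + 1" by auto
    then have "w \<notin> D" using t_le[of w] xD by auto
    then have "rk w \<le> g w" using that by (auto simp: D_def covers_in_def)
    then show False using rk_cover[OF that] \<open>g x = g w + 1\<close> xD by simp
  qed
  \<comment> \<open>An upper cover \<open>y\<close> of equal value would belong to \<open>E\<close>
    with larger rank, against the choice of \<open>x\<close>. So raising \<open>x\<close> respects
    all its covers.\<close>
  moreover have "g y = g x + 1" if "covers_in P x y" for y
  proof (rule ccontr)
    assume "g y \<noteq> g x + 1"
    moreover have "g y \<in> {g x, g x + 1}" using g that by (auto simp: states_def)
    ultimately have "g y = g x" by auto
    then have "y \<in> E"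
      using that xD rk_cover[OF that] by (auto simp: E_def D_def covers_in_def)
    then show False using rk_le[of y] rk_cover[OF that] by simp
  qed
  moreover have "x \<noteq> bottom" using xD rk_bottom by auto
  ultimately have "h \<in> states"
    using g xD by (auto simp: states_def h_def covers_in_def)
  then have "step g h" using g by (auto simp: step_def h_def fun_eq_iff)
  moreover have "sum h P = sum g P + 1"
  proof -
    have "sum h P = h x + sum h (P - {x})" using fin xD by (simp add: sum.remove)
    also have "sum h (P - {x}) = sum g (P - {x})" by (rule sum.cong) (auto simp: h_def)
    finally show ?thesis using fin xD by (simp add: h_def sum.remove)
  qed
  ultimately show ?thesis by blast
qed

text \<open>Unit steps use up the deficit \<open>d\<close> one at a time; once it is 0, a state
  bounded by \<open>rk\<close> with the same sum equals \<open>rk\<close>.\<close>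

lemma walks_to_rk_nonempty:
  "g \<in> states \<Longrightarrow> sum g P + d = rank_sum P \<Longrightarrow> walks step d g rk \<noteq> {}"
proof (induction d arbitrary: g)
  case 0
  have "g x = rk x" for x
  proof (rule ccontr)
    assume ne: "g x \<noteq> rk x"
    then have "x \<in> P" using statesD(1)[OF 0(1)] rk_outside by metis
    moreover have "g x < rk x" using ne states_le_rk[OF 0(1), of x] by simp
    ultimately have "sum g P < sum rk P"
      using states_le_rk[OF 0(1)] by (intro sum_strict_mono_ex1[OF fin]) auto
    with 0 show False by (simp add: rank_sum_def)
  qed
  then have "g = rk" by auto
  then show ?case by (simp add: walks_0)
next
  case (Suc d)
  obtain h where h: "step g h" "sum h P = sum g P + 1"
    using unit_step_exists Suc.prems by fastforce
  have "h \<in> states" using h by (simp add: step_def)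
  then have "walks step d h rk \<noteq> {}" using Suc.prems h(2) by (intro Suc.IH) simp_all
  then show ?case using h by (auto simp: walks_Suc)
qed

section \<open>Correspondence between quilts and walks\<close>

definition rows :: "nat \<Rightarrow> ('a \<times> nat \<Rightarrow> nat) \<Rightarrow> nat \<Rightarrow> 'a \<Rightarrow> nat" where
  "rows n f = (\<lambda>i x. if x \<in> P then f (x, min i n) else 0)"

text \<open>Separates covers along the chain, which compare consecutive rows, from covers in
  \<open>P\<close>, which act within a row. The bound on \<open>n\<close> turns the minimum in the
  corner condition into the rank of \<open>P\<close>.\<close>

lemma quilts_chain_iff:
  assumes "poset_rank P \<le> n"
  shows "f \<in> quilts P (chain_poset n) \<longleftrightarrow>
    f \<in> extensional (P \<times> {0..n}) \<and> (\<forall>x\<in>P. f (x, 0) = 0) \<and> (\<forall>i\<le>n. f (bottom, i) = 0) \<and>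
    f (topmost, n) = rk topmost \<and>
    (\<forall>x\<in>P. \<forall>i<n. f (x, Suc i) \<in> {f (x, i), f (x, i) + 1}) \<and>
    (\<forall>x y. \<forall>i\<le>n. covers_in P x y \<longrightarrow> f (y, i) \<in> {f (x, i), f (x, i) + 1})"
proof -
  have rank: "min (poset_rank P) (poset_rank (chain_poset n)) = rk topmost"
    using assms unfolding poset_rank_chain_poset by (simp add: poset_rank_def)
  have mem: "i \<in> chain_poset n \<longleftrightarrow> i \<le> n" for i by (simp add: chain_poset_def)
  have ext: "f \<in> P \<times> chain_poset n \<rightarrow>\<^sub>E UNIV \<longleftrightarrow> f \<in> extensional (P \<times> {0..n})"
    by (auto simp: PiE_def chain_poset_def)
  have zero: "(\<forall>x\<in>P. \<forall>y\<in>chain_poset n. x = bottom \<or> y = 0 \<longrightarrow> f (x, y) = 0) \<longleftrightarrow>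
      (\<forall>x\<in>P. f (x, 0) = 0) \<and> (\<forall>i\<le>n. f (bottom, i) = 0)" (is "?L \<longleftrightarrow> ?R")
  proof
    assume L: ?L
    show ?R
    proof (intro conjI ballI allI impI)
      show "f (x, 0) = 0" if "x \<in> P" for x using bspec[OF bspec[OF L that], of 0] mem by simp
      show "f (bottom, i) = 0" if "i \<le> n" for i
        using bspec[OF bspec[OF L bottom_mem], of i] mem that by simp
    qed
  next
    show "?R \<Longrightarrow> ?L" using mem by auto
  qed
  have cover: "(\<forall>x y x' y'. covers_in (P \<times> chain_poset n) (x, y) (x', y') \<longrightarrow>
        f (x', y') \<in> {f (x, y), f (x, y) + 1}) \<longleftrightarrow>
    (\<forall>x\<in>P. \<forall>i<n. f (x, Suc i) \<in> {f (x, i), f (x, i) + 1}) \<and>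
    (\<forall>x y. \<forall>i\<le>n. covers_in P x y \<longrightarrow> f (y, i) \<in> {f (x, i), f (x, i) + 1})"
    (is "?L \<longleftrightarrow> ?R")
  proof
    assume L: ?L
    show ?R
    proof (intro conjI ballI allI impI)
      show "f (x, Suc i) \<in> {f (x, i), f (x, i) + 1}" if "x \<in> P" "i < n" for x i
        by (rule L[rule_format])
           (use that in \<open>simp add: covers_in_Times covers_in_chain_poset\<close>)
      show "f (y, i) \<in> {f (x, i), f (x, i) + 1}" if "i \<le> n" "covers_in P x y" for x y i
        by (rule L[rule_format]) (use that mem in \<open>simp add: covers_in_Times\<close>)
    qed
  next
    assume R: ?R
    show ?L
    proof (intro allI impI)
      fix x i y j assume "covers_in (P \<times> chain_poset n) (x, i) (y, j)"
      then consider "x = y" "x \<in> P" "j = Suc i" "Suc i \<le> n" | "i = j" "i \<le> n" "covers_in P x y"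
        unfolding covers_in_Times covers_in_chain_poset mem by blast
      then show "f (y, j) \<in> {f (x, i), f (x, i) + 1}"
      proof cases
        case 1
        then show ?thesis using R[THEN conjunct1, rule_format, of x i] by simp
      next
        case 2
        then show ?thesis using R[THEN conjunct2, rule_format, of i x y] by simp
      qed
    qed
  qed
  show ?thesis
    by (simp only: quilts_def mem_Collect_eq Least_chain_poset Greatest_chain_poset
        rank ext zero cover conj_assoc)
qed

lemma rows_state:
  assumes "poset_rank P \<le> n" "f \<in> quilts P (chain_poset n)"
  shows "rows n f i \<in> states"
  using assms(2) bottom_mem unfolding quilts_chain_iff[OF assms(1)]
  by (auto simp: rows_def states_def covers_in_def)

text \<open>Covers along the chain give the steps, and \<open>state_eq_rk\<close> upgrades the
  corner value to the whole last row.\<close>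

lemma rows_walk:
  assumes n: "poset_rank P \<le> n" and f: "f \<in> quilts P (chain_poset n)"
  shows "rows n f \<in> walks step\<^sup>=\<^sup>= n (\<lambda>_. 0) rk"
proof -
  note q = f[unfolded quilts_chain_iff[OF n]]
  have "rows n f i = rk" if "n \<le> i" for i
    using that q topmost_mem by (intro state_eq_rk rows_state[OF n f]) (simp add: rows_def)
  moreover have "rows n f 0 = (\<lambda>_. 0)" using q by (auto simp: rows_def)
  moreover have "step\<^sup>=\<^sup>= (rows n f i) (rows n f (Suc i))" if "i < n" for i
  proof -
    have "f (x, Suc i) \<in> {f (x, i), f (x, i) + 1}" if "x \<in> P" for x using q that \<open>i < n\<close> by blast
    then have "rows n f (Suc i) x \<in> {rows n f i x, rows n f i x + 1}" for x
      using that by (simp add: rows_def)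
    then show ?thesis using rows_state[OF n f] by (simp add: step_def)
  qed
  ultimately show ?thesis by (auto simp: walks_def)
qed

text \<open>A trivial step is possible at any map, so being a state has to be carried along from the
  zero map.\<close>

lemma walk_states:
  assumes "g \<in> walks step\<^sup>=\<^sup>= n (\<lambda>_. 0) rk"
  shows "g i \<in> states"
proof (cases "i \<le> n")
  case True
  then show ?thesis
  proof (induction i)
    case (Suc i)
    then have "step\<^sup>=\<^sup>= (g i) (g (Suc i))" using assms by (simp add: walks_def)
    with Suc show ?case by (auto simp: step_def)
  qed (use assms zero_state in \<open>simp add: walks_def\<close>)
next
  case False
  then show ?thesis using assms rk_state by (simp add: walks_def)
qed

lemma bij_betw_rows:
  assumes n: "poset_rank P \<le> n"
  shows "bij_betw (rows n) (quilts P (chain_poset n)) (walks step\<^sup>=\<^sup>= n (\<lambda>_. 0) rk)"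
proof (rule bij_betwI[where g = "\<lambda>g. \<lambda>(x, i)\<in>P \<times> {0..n}. g i x"])
  show "rows n \<in> quilts P (chain_poset n) \<rightarrow> walks step\<^sup>=\<^sup>= n (\<lambda>_. 0) rk"
    using rows_walk[OF n] by blast
next
  show "(\<lambda>g. \<lambda>(x, i)\<in>P \<times> {0..n}. g i x) \<in> walks step\<^sup>=\<^sup>= n (\<lambda>_. 0) rk \<rightarrow> quilts P (chain_poset n)"
  proof
    fix g assume g: "g \<in> walks step\<^sup>=\<^sup>= n (\<lambda>_. 0) rk"
    have st: "g i bottom = 0" "covers_in P x y \<Longrightarrow> g i y \<in> {g i x, g i x + 1}" for i x y
      using walk_states[OF g, of i] by (auto simp: states_def)
    have "g (Suc i) x \<in> {g i x, g i x + 1}" if "i < n" for i x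
    proof -
      have "step\<^sup>=\<^sup>= (g i) (g (Suc i))" using g that by (simp add: walks_def)
      then show ?thesis by (auto simp: step_def)
    qed
    moreover have "g 0 = (\<lambda>_. 0)" "g n = rk" using g by (auto simp: walks_def)
    ultimately show "(\<lambda>(x, i)\<in>P \<times> {0..n}. g i x) \<in> quilts P (chain_poset n)"
      unfolding quilts_chain_iff[OF n] using st topmost_mem bottom_mem
      by (auto simp: covers_in_def)
  qed
next
  fix f assume "f \<in> quilts P (chain_poset n)"
  then have "f \<in> extensional (P \<times> {0..n})" unfolding quilts_chain_iff[OF n] by blast
  then show "(\<lambda>(x, i)\<in>P \<times> {0..n}. rows n f i x) = f"
    by (auto simp: rows_def fun_eq_iff restrict_def extensional_def)
next
  fix g assume g: "g \<in> walks step\<^sup>=\<^sup>= n (\<lambda>_. 0) rk"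
  have "g i x = 0" if "x \<notin> P" for i x using walk_states[OF g, of i] that by (simp add: states_def)
  \<comment> \<open>Walks are constant from \<open>n\<close> on, so cutting off the index at
    \<open>n\<close> loses nothing.\<close>
  moreover have "g (min i n) = g i" for i
    using g by (cases "i \<le> n") (auto simp: walks_def min_def)
  ultimately show "rows n (\<lambda>(x, i)\<in>P \<times> {0..n}. g i x) = g"
    by (auto simp: rows_def fun_eq_iff)
qed

lemma card_quilts_chain:
  assumes "poset_rank P \<le> n"
  shows "card (quilts P (chain_poset n)) =
    (\<Sum>m\<le>n. card (walks step m (\<lambda>_. 0) rk) * (n choose m))"
  unfolding bij_betw_same_card[OF bij_betw_rows[OF assms]]
  by (rule card_walks_reflclp) (auto simp: finite_step, simp add: step_def)

section \<open>Jumps and fundamental quilts\<close>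

lemma Suc_mem_jumps_iff:
  assumes f: "f \<in> quilts P (chain_poset (rank_sum P))" and i: "i < rank_sum P"
  shows "Suc i \<in> jumps P f \<longleftrightarrow> rows (rank_sum P) f i \<noteq> rows (rank_sum P) f (Suc i)"
proof -
  have "f (x, Suc i) \<in> {f (x, i), f (x, i) + 1}" if "x \<in> P" for x
    using f i that unfolding quilts_chain_iff[OF rank_le_rank_sum] by blast
  \<comment> \<open>Entries change by 0 or 1 only, so any change of the row is a jump.\<close>
  then have "(\<exists>x\<in>P. f (x, Suc i) = f (x, i) + 1) \<longleftrightarrow> (\<exists>x\<in>P. f (x, i) \<noteq> f (x, Suc i))"
    by (intro bex_cong refl) fastforce
  then show ?thesis using i by (auto simp: jumps_def rows_def fun_eq_iff)
qed

text \<open>Jumps forming \<open>{1..m}\<close> means that all strict steps come first and the walk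
  then rests. As walks are prolonged by their end point, the same function is then a strict walk of
  \<open>m\<close> steps.\<close>

lemma jumps_eq_iff_walk:
  assumes f: "f \<in> quilts P (chain_poset (rank_sum P))" and m: "m \<le> rank_sum P"
  shows "jumps P f = {1..m} \<longleftrightarrow> rows (rank_sum P) f \<in> walks step m (\<lambda>_. 0) rk"
proof -
  let ?b = "rank_sum P" let ?g = "rows ?b f"
  have g: "?g 0 = (\<lambda>_. 0)" "\<And>i. i < ?b \<Longrightarrow> step\<^sup>=\<^sup>= (?g i) (?g (Suc i))" "\<And>i. ?b \<le> i \<Longrightarrow> ?g i = rk"
    using rows_walk[OF rank_le_rank_sum f] by (auto simp: walks_def)
  have sub: "jumps P f \<subseteq> {1..?b}" by (auto simp: jumps_def)
  show ?thesis
  proof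
    assume J: "jumps P f = {1..m}"
    have "step (?g i) (?g (Suc i))" if "i < m" for i
    proof -
      have "Suc i \<in> jumps P f" "i < ?b" using that J m by auto
      then show ?thesis using Suc_mem_jumps_iff[OF f] g(2)[of i] by auto
    qed
    moreover have "?g i = rk" if "m \<le> i" for i
    proof (cases "i \<le> ?b")
      case True
      \<comment> \<open>Downward from \<open>rank_sum P\<close>, where the row is \<open>rk\<close>:
        without a jump, two neighbouring rows agree.\<close>
      then show ?thesis
        using that
      proof (induction i rule: inc_induct)
        case (step i)
        then have "Suc i \<notin> jumps P f" using J by simp
        then show ?case using Suc_mem_jumps_iff[OF f] step by simp
      qed (simp add: g(3))
    qed (simp add: g(3))
    ultimately show "?g \<in> walks step m (\<lambda>_. 0) rk" using g(1) by (simp add: walks_def)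
  next
    assume w: "?g \<in> walks step m (\<lambda>_. 0) rk"
    have "Suc i \<in> jumps P f \<longleftrightarrow> i < m" for i
    proof (cases "i < ?b")
      case True
      then show ?thesis
        using w Suc_mem_jumps_iff[OF f True] by (cases "i < m") (auto simp: walks_def step_def)
    next
      case False
      then show ?thesis using sub m by auto
    qed
    moreover have "0 \<notin> jumps P f" using sub by auto
    ultimately have "j \<in> jumps P f \<longleftrightarrow> j \<in> {1..m}" for j by (cases j) (auto simp: Suc_le_eq)
    then show "jumps P f = {1..m}" by blast
  qed
qed

text \<open>A strict walk of \<open>m\<close> steps, followed by rests at \<open>rk\<close>, is a
  weak walk of \<open>rank_sum P\<close> steps and so comes from a quilt; \<open>rows\<close> then
  restricts to a bijection.\<close>

lemma card_fundamental_quilts: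
  assumes m: "m \<le> rank_sum P"
  shows "card (fundamental_quilts m P) = card (walks step m (\<lambda>_. 0) rk)"
proof -
  let ?b = "rank_sum P"
  let ?W = "walks step m (\<lambda>_. 0) rk"
  have bij: "bij_betw (rows ?b) (quilts P (chain_poset ?b)) (walks step\<^sup>=\<^sup>= ?b (\<lambda>_. 0) rk)"
    by (rule bij_betw_rows[OF rank_le_rank_sum])
  have eq: "fundamental_quilts m P = {f \<in> quilts P (chain_poset ?b). rows ?b f \<in> ?W}"
    using jumps_eq_iff_walk[OF _ m] by (auto simp: fundamental_quilts_def)
  have "g \<in> walks step\<^sup>=\<^sup>= ?b (\<lambda>_. 0) rk" if g: "g \<in> ?W" for g
  proof -
    have "step\<^sup>=\<^sup>= (g i) (g (Suc i))" for i
      using g by (cases "i < m") (auto simp: walks_def)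
    then show ?thesis using g m by (simp add: walks_def)
  qed
  then have "?W \<subseteq> rows ?b ` quilts P (chain_poset ?b)"
    unfolding bij_betw_imp_surj_on[OF bij] by blast
  then have "rows ?b ` fundamental_quilts m P = ?W"
    unfolding eq by blast
  moreover have "inj_on (rows ?b) (fundamental_quilts m P)"
    using bij_betw_imp_inj_on[OF bij] by (rule inj_on_subset) (simp add: eq)
  ultimately show ?thesis by (metis card_image)
qed

text \<open>The walk of unit steps from the zero map has exactly \<open>rank_sum P\<close> steps.
  Positivity allows division by the leading coefficient.\<close>

lemma card_standard_quilts_pos: "0 < card (standard_quilts P)"
proof -
  have "walks step (rank_sum P) (\<lambda>_. 0) rk \<noteq> {}"
    by (rule walks_to_rk_nonempty) (simp_all add: zero_state)
  moreover have "finite (walks step (rank_sum P) (\<lambda>_. 0) rk)"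
    by (rule finite_walks) (rule finite_step)
  ultimately show ?thesis
    unfolding standard_quilts_def card_fundamental_quilts[OF order.refl] by (simp add: card_gt_0_iff)
qed

lemma card_quilts_chain_fundamental:
  assumes "poset_rank P \<le> n"
  shows "card (quilts P (chain_poset n)) =
    (\<Sum>m=poset_rank P..rank_sum P. card (fundamental_quilts m P) * (n choose m))"
proof -
  let ?w = "\<lambda>m. card (walks step m (\<lambda>_. 0) rk) * (n choose m)"
  have zero: "?w m = 0" if "m \<notin> {poset_rank P..rank_sum P}" for m
  proof -
    have "walks step m (\<lambda>_. 0) rk = {}" using that walk_length by fastforce
    then show ?thesis by simp
  qed
  have "card (quilts P (chain_poset n)) = (\<Sum>m\<le>n. ?w m)"
    by (rule card_quilts_chain[OF assms])
  \<comment> \<open>Neither range need contain the other. Terms outside the rank bounds lack strict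
    walks, and terms with \<open>m > n\<close> have binomial coefficient 0.\<close>
  also have "\<dots> = sum ?w ({..n} \<inter> {poset_rank P..rank_sum P})"
    by (intro sum.mono_neutral_right ballI zero) auto
  also have "\<dots> = sum ?w {poset_rank P..rank_sum P}"
    by (intro sum.mono_neutral_left) (auto simp: binomial_eq_0)
  also have "\<dots> = (\<Sum>m=poset_rank P..rank_sum P. card (fundamental_quilts m P) * (n choose m))"
    by (intro sum.cong) (auto simp: card_fundamental_quilts)
  finally show ?thesis .
qed

end

subsection \<open>Binomial coefficients as polynomials\<close>

text \<open>The falling factorial of degree \<open>m\<close> divided by
  \<open>fact m\<close>.\<close>

definition binomial_poly :: "nat \<Rightarrow> real poly" where
  "binomial_poly m = smult (1 / fact m) (\<Prod>i<m. [:- real i, 1:])"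

lemma poly_binomial_poly: "poly (binomial_poly m) (real n) = real (n choose m)"
  by (simp add: binomial_poly_def poly_prod binomial_gbinomial gbinomial_prod_rev lessThan_atLeast0
      field_simps)

lemma binomial_over_power_tendsto:
  "(\<lambda>n. real (n choose m) / real n ^ m) \<longlonglongrightarrow> 1 / fact m"
proof -
  have "(\<lambda>n. (\<Prod>i<m. 1 - real i / real n) / fact m) \<longlonglongrightarrow> (\<Prod>i<m. 1 - 0) / fact m"
    by (intro tendsto_divide tendsto_prod tendsto_diff tendsto_const lim_const_over_n) auto
  moreover have "\<forall>\<^sub>F n in sequentially. (\<Prod>i<m. 1 - real i / real n) / fact m = real (n choose m) / real n ^ m"
  \<comment> \<open>Each of the \<open>m\<close> factors \<open>n - i\<close> takes one factor of
    \<open>n ^ m\<close>, which requires \<open>n\<close> to be nonzero.\<close>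
  proof (rule eventually_sequentiallyI[of 1])
    fix n :: nat assume "1 \<le> n"
    then have "(\<Prod>i<m. 1 - real i / real n) = (\<Prod>i<m. (real n - real i) / real n)"
      by (intro prod.cong) (auto simp: field_simps)
    then show "(\<Prod>i<m. 1 - real i / real n) / fact m = real (n choose m) / real n ^ m"
      by (simp add: poly_binomial_poly[symmetric] binomial_poly_def poly_prod prod_dividef)
  qed
  ultimately show ?thesis by (simp add: tendsto_cong)
qed

lemma binomial_over_larger_power_tendsto:
  assumes "m < b"
  shows "(\<lambda>n. real (n choose m) / real n ^ b) \<longlonglongrightarrow> 0"
proof -
  have "(\<lambda>n. real (n choose m) / real n ^ m * (1 / real n) ^ (b - m)) \<longlonglongrightarrow> 1 / fact m * 0 ^ (b - m)"
    by (intro tendsto_mult binomial_over_power_tendsto tendsto_power lim_const_over_n)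
  moreover have "real (n choose m) / real n ^ m * (1 / real n) ^ (b - m) = real (n choose m) / real n ^ b" for n
    using assms by (simp add: power_one_over divide_simps flip: power_add)
  ultimately show ?thesis using assms by (simp add: power_0_left)
qed

text \<open>Only the term \<open>m = b\<close> survives in the limit, and it occurs because
  \<open>k \<le> b\<close>.\<close>

lemma binomial_sum_over_power_tendsto:
  fixes c :: "nat \<Rightarrow> real"
  assumes "k \<le> b"
  shows "(\<lambda>n. (\<Sum>m=k..b. c m * real (n choose m)) / real n ^ b) \<longlonglongrightarrow> c b / fact b"
proof -
  have "(\<lambda>n. \<Sum>m=k..b. c m * (real (n choose m) / real n ^ b))
      \<longlonglongrightarrow> (\<Sum>m=k..b. c m * (if m = b then 1 / fact b else 0))"
    by (intro tendsto_sum tendsto_mult tendsto_const)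
       (auto simp: binomial_over_power_tendsto binomial_over_larger_power_tendsto)
  then show ?thesis using assms by (simp add: sum_divide_distrib if_distrib sum.delta cong: if_cong)
qed

theorem theorem7p1:
  fixes P :: "'a::order set" and k :: nat
  assumes "ranked_poset P" and "poset_rank P = k"
  shows "(\<forall>n\<ge>k. card (quilts P (chain_poset n)) =
            (\<Sum>m=k..rank_sum P. card (fundamental_quilts m P) * (n choose m))) \<and>
         (\<exists>p :: real poly. \<forall>n\<ge>k. real (card (quilts P (chain_poset n))) = poly p (real n)) \<and>
         (\<lambda>n. real (card (quilts P (chain_poset n))) /
            (real (card (standard_quilts P)) / fact (rank_sum P) * real n ^ rank_sum P))
           \<longlonglongrightarrow> 1"
proof -
  interpret ranked P by unfold_locales (rule assms(1))
  let ?b = "rank_sum P"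
  let ?F = "\<lambda>m. card (fundamental_quilts m P)"
  have count: "card (quilts P (chain_poset n)) = (\<Sum>m=k..?b. ?F m * (n choose m))" if "n \<ge> k" for n
    using card_quilts_chain_fundamental that assms(2) by blast
  have "real (card (quilts P (chain_poset n))) =
      poly (\<Sum>m=k..?b. smult (real (?F m)) (binomial_poly m)) (real n)" if "n \<ge> k" for n
    by (simp add: count[OF that] poly_sum poly_binomial_poly)
  moreover have "(\<lambda>n. real (card (quilts P (chain_poset n))) /
      (real (card (standard_quilts P)) / fact ?b * real n ^ ?b)) \<longlonglongrightarrow> 1"
  proof -
    let ?c = "real (card (standard_quilts P)) / fact ?b"
    have "?c \<noteq> 0" using card_standard_quilts_pos by simp
    have "(\<lambda>n. (\<Sum>m=k..?b. real (?F m) * real (n choose m)) / real n ^ ?b / ?c) \<longlonglongrightarrow> ?c / ?c"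
      unfolding standard_quilts_def
    proof (rule tendsto_divide[OF binomial_sum_over_power_tendsto tendsto_const])
      show "k \<le> ?b" using rank_le_rank_sum assms(2) by simp
      show "real (?F ?b) / fact ?b \<noteq> 0" using \<open>?c \<noteq> 0\<close> by (simp add: standard_quilts_def)
    qed
    moreover have "\<forall>\<^sub>F n in sequentially. (\<Sum>m=k..?b. real (?F m) * real (n choose m)) / real n ^ ?b / ?c
        = real (card (quilts P (chain_poset n))) / (?c * real n ^ ?b)"
      \<comment> \<open>The counting formula is available from \<open>n = k\<close> on, which
        suffices for the limit.\<close>
      by (rule eventually_sequentiallyI[of k]) (simp add: count mult.commute)
    ultimately show ?thesis using \<open>?c \<noteq> 0\<close> by (simp add: tendsto_cong)
  qed
  ultimately show ?thesis using count by blast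
qed

end
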